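(* Let $D>0$ be a non-square discriminant and $k\in 2\mathbb{N}$. Let $\tau\in\mathbb{H}$ and $w\in\mathbb{H}^-$. Then the function $\Omega_{k+1,D}\colon\mathbb{H}\times\mathbb{H}^-\to\mathbb{C}$, $$\Omega_{k+1,D}(\tau,w)=\psi_{k+1,D}(\tau)-\rho_{k+1,D}(\tau,w)+2\pi i\,\varphi_{k+1,D}(\tau)+\lambda_{k+1,D}(\tau,w),$$ satisfies the following. (1) $\Omega_{k+1,D}$ is bimodular of weight $(2k+2,0)$, that is, $$\Omega_{k+1,D}(\tau+1,w+1)=\Omega_{k+1,D}(\tau,w),\qquad \Omega_{k+1,D}\left(-\frac1\tau,-\frac1w\right)=\tau^{2k+2}\,\Omega_{k+1,D}(\tau,w).$$ (2) $\lim_{w\to-i\infty}\Omega_{k+1,D}(\tau,w)=\psi_{k+1,D}(\tau)$. (3) $\lim_{\tau\to i\infty}\Omega_{k+1,D}(\tau,w)=0$. (4) $\Omega_{k+1,D}$ is holomorphic with respect to $\tau$ and anti-holomorphic with respect to $w$. (5) $\Omega_{k+1,D}(\tau,\overline{\tau})=0$.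
   Context: Here $\mathbb{N}=\{1,2,3,\dots\}$, $\mathbb{H}$ is the complex upper half-plane and $\mathbb{H}^-=-\mathbb{H}$ is the lower half-plane. A discriminant is an integer $\equiv 0,1\pmod 4$. $\mathcal{Q}_D$ is the set of integral binary quadratic forms $Q=[a,b,c]$, $Q(x,y)=ax^2+bxy+cy^2$ with $a,b,c\in\mathbb{Z}$ and $b^2-4ac=D$ (since $D$ is not a square, $a\neq0$ and $c\ne 0$). $\operatorname{Log}$ is the principal branch of the complex logarithm. For $Q=[a,b,c]\in\mathcal{Q}_D$ put $\alpha_Q^{\pm}=\frac{-b\pm\sqrt D}{2a}\in\mathbb{R}$, $\operatorname{sgn}(Q)=\operatorname{sgn}(a)$, and for $w\in\mathbb{C}\setminus\mathbb{R}$ put $Q_w=\frac{1}{\operatorname{Im}(w)}\left(a|w|^2+b\operatorname{Re}(w)+c\right)$. For $\tau\in\mathbb{H}$, $w\in\mathbb{H}^-$ define the (absolutely convergent) series $$\psi_{k+1,D}(\tau)=\sum_{Q\in\mathcal{Q}_D}\frac{\operatorname{Log}\left(\frac{\tau-\alpha_Q^-}{\tau-\alpha_Q^+}\right)}{Q(\tau,1)^{k+1}},\qquad \rho_{k+1,D}(\tau,w)=\sum_{Q\in\mathcal{Q}_D}\frac{\operatorname{Log}\left(\frac{w-\alpha_Q^-}{w-\alpha_Q^+}\right)}{Q(\tau,1)^{k+1}},$$ $$\varphi_{k+1,D}(\tau)=\frac12\sum_{Q\in\mathcal{Q}_D}\frac{\operatorname{sgn}(Q)}{Q(\tau,1)^{k+1}},\qquad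 \lambda_{k+1,D}(\tau,w)=2i\sum_{Q\in\mathcal{Q}_D}\frac{\arctan\left(\frac{Q_w}{\sqrt D}\right)}{Q(\tau,1)^{k+1}}.$$ The limit $\tau\to i\infty$ means $\operatorname{Im}(\tau)\to\infty$ and $w\to-i\infty$ means $\operatorname{Im}(w)\to-\infty$. *)

theory Defs
  imports "HOL-Complex_Analysis.Complex_Analysis" "HOL-Computational_Algebra.Nth_Powers"
begin

definition upper_half_plane :: "complex set" where
  "upper_half_plane = {z. Im z > 0}"

definition lower_half_plane :: "complex set" where
  "lower_half_plane = {z. Im z < 0}"

definition antiholomorphic_on :: "(complex \<Rightarrow> complex) \<Rightarrow> complex set \<Rightarrow> bool" where
  "antiholomorphic_on f S \<longleftrightarrow> (\<lambda>z. cnj (f z)) holomorphic_on S"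

definition discriminant :: "int \<Rightarrow> bool" where
  "discriminant D \<longleftrightarrow> D mod 4 = 0 \<or> D mod 4 = 1"

text \<open>The triple \<open>(a, b, c)\<close> stands for the form $[a,b,c] = ax^2 + bxy + cy^2$.\<close>

type_synonym bqf = "int \<times> int \<times> int"

definition forms :: "int \<Rightarrow> bqf set" where
  "forms D = {(a, b, c). b^2 - 4 * a * c = D}"

fun form_eval :: "bqf \<Rightarrow> complex \<Rightarrow> complex \<Rightarrow> complex" where
  "form_eval (a, b, c) x y = of_int a * x^2 + of_int b * x * y + of_int c * y^2"

fun form_sgn :: "bqf \<Rightarrow> int" where
  "form_sgn (a, b, c) = sgn a"

text \<open>The roots and the value $Q_w$ use division, with the junk value \<open>x / 0 = 0\<close>; the statement
  only evaluates them at $a \neq 0$ ($D$ is not a square) and at $w \notin \mathbb{R}$.\<close>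

fun root_plus :: "int \<Rightarrow> bqf \<Rightarrow> real" where
  "root_plus D (a, b, c) = (- of_int b + sqrt (of_int D)) / (2 * of_int a)"

fun root_minus :: "int \<Rightarrow> bqf \<Rightarrow> real" where
  "root_minus D (a, b, c) = (- of_int b - sqrt (of_int D)) / (2 * of_int a)"

fun form_at :: "bqf \<Rightarrow> complex \<Rightarrow> real" where
  "form_at (a, b, c) w = (of_int a * (cmod w)^2 + of_int b * Re w + of_int c) / Im w"

text \<open>The index \<open>m\<close> below is the $k+1$ of $\psi_{k+1,D}$, etc. For complex-valued families
  summability in the sense of \<^const>\<open>infsum\<close> is the same as absolute summability.\<close>

definition psi :: "nat \<Rightarrow> int \<Rightarrow> complex \<Rightarrow> complex" where
  "psi m D \<tau> = (\<Sum>\<^sub>\<infinity>Q\<in>forms D.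
     Ln ((\<tau> - of_real (root_minus D Q)) / (\<tau> - of_real (root_plus D Q))) / form_eval Q \<tau> 1 ^ m)"

definition rho :: "nat \<Rightarrow> int \<Rightarrow> complex \<Rightarrow> complex \<Rightarrow> complex" where
  "rho m D \<tau> w = (\<Sum>\<^sub>\<infinity>Q\<in>forms D.
     Ln ((w - of_real (root_minus D Q)) / (w - of_real (root_plus D Q))) / form_eval Q \<tau> 1 ^ m)"

definition phi :: "nat \<Rightarrow> int \<Rightarrow> complex \<Rightarrow> complex" where
  "phi m D \<tau> = 1/2 * (\<Sum>\<^sub>\<infinity>Q\<in>forms D. of_int (form_sgn Q) / form_eval Q \<tau> 1 ^ m)"

definition lambda :: "nat \<Rightarrow> int \<Rightarrow> complex \<Rightarrow> complex \<Rightarrow> complex" where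
  "lambda m D \<tau> w = 2 * \<i> * (\<Sum>\<^sub>\<infinity>Q\<in>forms D.
     of_real (arctan (form_at Q w / sqrt (of_int D))) / form_eval Q \<tau> 1 ^ m)"

definition Omega :: "nat \<Rightarrow> int \<Rightarrow> complex \<Rightarrow> complex \<Rightarrow> complex" where
  "Omega m D \<tau> w = psi m D \<tau> - rho m D \<tau> w + 2 * of_real pi * \<i> * phi m D \<tau> + lambda m D \<tau> w"

end

theory Submission
  imports Defs "HOL-Real_Asymp.Real_Asymp"
begin

text \<open>For a form \<open>Q\<close> write \<open>L\<^sub>Q z = Ln ((z - \<alpha>\<^sub>Q\<^sup>-) / (z - \<alpha>\<^sub>Q\<^sup>+))\<close>. For \<open>w\<close> in the lower half-plane
  \<open>Im (L\<^sub>Q w) = arctan (Q\<^sub>w / \<surd>D) + sgn Q * \<pi> / 2\<close>, so in the combination of \<open>\<rho>\<close>, \<open>\<phi>\<close> and \<open>\<lambda>\<close> every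
  \<open>L\<^sub>Q w\<close> turns into its conjugate \<open>L\<^sub>Q (cnj w)\<close>, and
  \<open>\<Omega>(\<tau>, w) = (\<Sum>Q. (L\<^sub>Q \<tau> - L\<^sub>Q (cnj w)) / Q(\<tau>, 1)^(k + 1))\<close>.
  The behaviour on the diagonal and the (anti)holomorphy can be read off. Modularity follows since
  \<open>L\<^sub>Q' = - \<surd>D / Q(z, 1)\<close>, so the difference of logarithms is an integral of \<open>- \<surd>D dz / Q(z, 1)\<close>, which
  is equivariant. The limits follow from \<open>\<bar>L\<^sub>Q z\<bar> \<le> \<pi> + \<surd>D / \<bar>Im z\<bar>\<close>, from \<open>L\<^sub>Q z \<rightarrow> 0\<close> uniformly in \<open>Q\<close> as
  \<open>\<bar>Im z\<bar> \<rightarrow> \<infinity>\<close>, and from the convergence of \<open>\<Sum>Q. \<bar>Q(\<i>, 1)\<bar> powr -s\<close> for \<open>s > 2\<close>.\<close>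

section \<open>Summability, holomorphic sums and bounds for the logarithm\<close>

lemma summable_on_abs_int_powr:
  fixes s :: real
  assumes "s < -1"
  shows "(\<lambda>n::int. of_int \<bar>n\<bar> powr s) summable_on UNIV"
proof -
  have nat: "(\<lambda>n::nat. of_nat n powr s :: real) summable_on UNIV"
    using assms by (intro summable_nonneg_imp_summable_on) (simp_all add: summable_real_powr_iff)
  have pos: "(\<lambda>n::int. of_int \<bar>n\<bar> powr s) summable_on range int"
    by (subst summable_on_reindex) (use nat in \<open>simp_all add: o_def\<close>)
  have "inj (\<lambda>n. - int n)"
    by (auto intro: injI)
  then have neg: "(\<lambda>n::int. of_int \<bar>n\<bar> powr s) summable_on range (\<lambda>n. - int n)"
    by (subst summable_on_reindex) (use nat in \<open>simp_all add: o_def\<close>)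
  have "range int \<union> range (\<lambda>n. - int n) = UNIV"
    by (auto intro: int_cases2)
  with summable_on_union[OF pos neg] show ?thesis
    by simp
qed

text \<open>Weierstrass M-test on a closed disc inside \<open>U \<inter> A\<close>: domination makes
  the finite partial sums converge uniformly there, and a uniform limit of holomorphic functions is
  holomorphic in the interior.\<close>

lemma holomorphic_on_infsum:
  fixes f :: "'a \<Rightarrow> complex \<Rightarrow> complex"
  assumes hol: "\<And>x. x \<in> X \<Longrightarrow> f x holomorphic_on A" and "open A"
    and bound: "\<And>z. z \<in> A \<Longrightarrow> \<exists>U M. open U \<and> z \<in> U \<and> M summable_on X \<and>
                  (\<forall>x\<in>X. \<forall>y\<in>U \<inter> A. norm (f x y) \<le> M x)"
  shows "(\<lambda>z. \<Sum>\<^sub>\<infinity>x\<in>X. f x z) holomorphic_on A"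
proof -
  have "(\<lambda>z. \<Sum>\<^sub>\<infinity>x\<in>X. f x z) field_differentiable at z" if z: "z \<in> A" for z
  proof -
    obtain U M where U: "open U" "z \<in> U" "M summable_on X"
      and M: "\<And>x y. x \<in> X \<Longrightarrow> y \<in> U \<inter> A \<Longrightarrow> norm (f x y) \<le> M x"
      using bound[OF z] by blast
    obtain r where r: "r > 0" "cball z r \<subseteq> U \<inter> A"
      using U z \<open>open A\<close> open_contains_cball by (metis IntI open_Int)
    have ulim: "uniform_limit (cball z r) (\<lambda>Y z. \<Sum>x\<in>Y. f x z) (\<lambda>z. \<Sum>\<^sub>\<infinity>x\<in>X. f x z)
            (finite_subsets_at_top X)"
    proof (rule Weierstrass_m_test_general)
      show "norm (f x y) \<le> M x" if "x \<in> X" "y \<in> cball z r" for x y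
        using M that r by blast
    qed (rule U)
    have ev: "\<forall>\<^sub>F Y in finite_subsets_at_top X.
        continuous_on (cball z r) (\<lambda>z. \<Sum>x\<in>Y. f x z) \<and> (\<lambda>z. \<Sum>x\<in>Y. f x z) holomorphic_on ball z r"
    proof (rule eventually_finite_subsets_at_top_weakI)
      fix Y assume Y: "finite Y" "Y \<subseteq> X"
      have "(\<lambda>z. \<Sum>x\<in>Y. f x z) holomorphic_on A"
        using Y hol by (intro holomorphic_intros) auto
      then have "(\<lambda>z. \<Sum>x\<in>Y. f x z) holomorphic_on cball z r"
        by (rule holomorphic_on_subset) (use r in auto)
      then show "continuous_on (cball z r) (\<lambda>z. \<Sum>x\<in>Y. f x z) \<and>
                 (\<lambda>z. \<Sum>x\<in>Y. f x z) holomorphic_on ball z r"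
        using holomorphic_on_imp_continuous_on holomorphic_on_subset ball_subset_cball by blast
    qed
    have "(\<lambda>z. \<Sum>\<^sub>\<infinity>x\<in>X. f x z) holomorphic_on ball z r"
      using holomorphic_uniform_limit[OF ev ulim] by simp
    then show ?thesis
      using \<open>r > 0\<close> by (simp add: holomorphic_on_imp_differentiable_at)
  qed
  then show ?thesis
    by (simp add: holomorphic_on_def field_differentiable_at_within)
qed

text \<open>The real part is \<open>ln\<close> of a ratio of moduli, controlled by
  \<open>ln x \<le> x - 1\<close>; the imaginary part of a principal logarithm never exceeds
  \<open>pi\<close> in modulus.\<close>

lemma norm_Ln_divide_le:
  fixes z1 z2 :: complex
  assumes y: "0 < y" "y \<le> norm z1" "y \<le> norm z2" and d: "norm (z1 - z2) \<le> d"
  shows "norm (Ln (z1 / z2)) \<le> pi + d / y"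
proof -
  have nz: "z1 \<noteq> 0" "z2 \<noteq> 0"
    using y by auto
  \<comment> \<open>Stated for arbitrary \<open>u\<close> and \<open>v\<close> because the absolute
    value of the real part needs both orders of \<open>z1\<close> and \<open>z2\<close>.\<close>
  have ln_le: "ln (norm u / norm v) \<le> d / y"
    if "y \<le> norm u" "y \<le> norm v" "norm (u - v) \<le> d" for u v :: complex
  proof -
    have pos: "norm u > 0" "norm v > 0"
      using that y(1) by linarith+
    have "ln (norm u / norm v) \<le> norm u / norm v - 1"
      using pos by (intro ln_le_minus_one) simp
    also have "\<dots> = (norm u - norm v) / norm v"
      using pos by (simp add: field_simps)
    also have "\<dots> \<le> d / norm v"
      using that pos norm_triangle_ineq2[of u v] by (intro divide_right_mono) auto
    also have "\<dots> \<le> d / y"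
      using that y(1) pos norm_ge_zero[of "u - v"] by (intro divide_left_mono mult_pos_pos) linarith+
    finally show ?thesis .
  qed
  have "\<bar>Re (Ln (z1 / z2))\<bar> \<le> d / y"
    using ln_le[of z1 z2] ln_le[of z2 z1] y d nz
    by (simp add: norm_divide norm_minus_commute ln_div abs_le_iff)
  moreover have "\<bar>Im (Ln (z1 / z2))\<bar> \<le> pi"
    using nz mpi_less_Im_Ln[of "z1 / z2"] Im_Ln_le_pi[of "z1 / z2"] by (simp add: abs_le_iff)
  ultimately show ?thesis
    using cmod_le[of "Ln (z1 / z2)"] by linarith
qed

text \<open>The quotient is within \<open>d / y < 1 / 2\<close> of 1, where
  \<open>Ln (1 + u)\<close> is at most twice \<open>u\<close> in norm. Unlike the bound with
  \<open>pi\<close>, this one tends to 0 as \<open>y\<close> grows.\<close>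

lemma norm_Ln_divide_le_small:
  fixes z1 z2 :: complex
  assumes "norm (z1 - z2) \<le> d" "2 * d < y" "y \<le> norm z2"
  shows "norm (Ln (z1 / z2)) \<le> 2 * d / y"
proof -
  have d: "d \<ge> 0"
    using assms(1) norm_ge_zero order_trans by blast
  have nz: "z2 \<noteq> 0"
    using assms d by auto
  have *: "norm (z1 / z2 - 1) \<le> d / y"
  proof -
    have "norm (z1 / z2 - 1) = norm (z1 - z2) / norm z2"
      using nz by (simp add: norm_divide[symmetric] diff_divide_distrib)
    also have "\<dots> \<le> d / y"
      using assms d by (intro frac_le) auto
    finally show ?thesis .
  qed
  have "d / y < 1 / 2"
    using assms d by (simp add: field_simps)
  then have "norm (Ln (1 + (z1 / z2 - 1))) \<le> 2 * norm (z1 / z2 - 1)"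
    using * by (intro norm_Ln_le) linarith
  with * show ?thesis by simp
qed

section \<open>Sums over forms of fixed discriminant\<close>

locale nonsquare_discriminant =
  fixes D :: int
  assumes D_pos: "D > 0" and D_nonsquare: "\<not> is_square D"
begin

text \<open>A vanishing outer coefficient would leave \<open>D = b^2\<close>, a square.\<close>

lemma forms_nonzero:
  assumes "(a, b, c) \<in> forms D"
  shows "a \<noteq> 0" "c \<noteq> 0"
  using assms D_nonsquare by (auto simp: forms_def)

lemma sqrt_D_pos: "sqrt (of_int D) > 0"
  using D_pos by simp

lemma form_eval_factor:
  assumes "(a, b, c) \<in> forms D"
  shows "form_eval (a, b, c) z 1 =
           of_int a * (z - of_real (root_minus D (a, b, c))) * (z - of_real (root_plus D (a, b, c)))"
proof -
  have a: "a \<noteq> 0" and D: "D = b^2 - 4 * a * c"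
    using assms forms_nonzero[OF assms] by (auto simp: forms_def)
  have sq: "(of_real (sqrt (of_int D)) :: complex) ^ 2 = of_int b ^ 2 - 4 * of_int a * of_int c"
  proof -
    have "(of_real (sqrt (of_int D)) :: complex) ^ 2 = of_real (of_int D)"
      using D_pos by (simp flip: of_real_power)
    then show ?thesis by (simp add: D)
  qed
  define A B C s :: complex where "A = of_int a" and "B = of_int b" and "C = of_int c"
    and "s = of_real (sqrt (of_int D))"
  have "A * (z - (- B - s) / (2 * A)) * (z - (- B + s) / (2 * A)) =
        A * z^2 + B * z + (B^2 - s^2) / (4 * A)"
    using a by (simp add: A_def field_simps power2_eq_square)
  also have "(B^2 - s^2) / (4 * A) = C"
    using a sq by (simp add: A_def B_def C_def s_def)
  finally show ?thesis
    by (simp add: A_def B_def C_def s_def)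
qed

lemma root_plus_minus_root_minus:
  "root_plus D (a, b, c) - root_minus D (a, b, c) = sqrt (of_int D) / of_int a"
  by (cases "a = 0") (simp_all add: field_simps)

text \<open>The gap is \<open>sqrt D / \<bar>a\<bar>\<close> with \<open>a\<close> a nonzero
  integer, so the bound is uniform over all forms.\<close>

lemma root_distance:
  assumes "Q \<in> forms D"
  shows "\<bar>root_plus D Q - root_minus D Q\<bar> \<le> sqrt (of_int D)"
    and "root_plus D Q \<noteq> root_minus D Q"
proof -
  obtain a b c where Q: "Q = (a, b, c)"
    by (cases Q) auto
  have a: "a \<noteq> 0"
    using assms forms_nonzero Q by auto
  then have "\<bar>real_of_int a\<bar> \<ge> 1"
    by linarith
  then show "\<bar>root_plus D Q - root_minus D Q\<bar> \<le> sqrt (of_int D)"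
    using sqrt_D_pos unfolding Q root_plus_minus_root_minus abs_divide
    by (auto simp: divide_le_eq intro: mult_left_le)
  show "root_plus D Q \<noteq> root_minus D Q"
    using root_plus_minus_root_minus[of a b c] a sqrt_D_pos Q by auto
qed

text \<open>The roots are real, so both linear factors have modulus at least
  \<open>\<bar>Im z\<bar>\<close>, and the leading coefficient has modulus at least 1.\<close>

lemma norm_form_eval_ge_Im:
  assumes "Q \<in> forms D" 
  shows "(Im z)^2 \<le> norm (form_eval Q z 1)"
proof -
  obtain a b c where Q: "Q = (a, b, c)"
    by (cases Q) auto
  have "a \<noteq> 0"
    using assms forms_nonzero Q by auto
  then have a: "\<bar>real_of_int a\<bar> \<ge> 1"
    by linarith
  have Im: "\<bar>Im z\<bar> \<le> norm (z - of_real r)" for r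
    using abs_Im_le_cmod[of "z - of_real r"] by simp
  have "1 * \<bar>Im z\<bar> * \<bar>Im z\<bar> \<le> norm (form_eval Q z 1)"
    unfolding Q form_eval_factor[OF assms[unfolded Q]] norm_mult norm_of_int
    by (intro mult_mono a Im) auto
  then show ?thesis
    by (simp add: power2_eq_square flip: abs_mult)
qed

lemma form_eval_nonzero:
  assumes "Q \<in> forms D" "Im z \<noteq> 0"
  shows "form_eval Q z 1 \<noteq> 0"
  using norm_form_eval_ge_Im[OF assms(1), of z] assms(2) 
  by (metis norm_zero power2_less_eq_zero_iff)

section \<open>Comparison with the point \<open>\<i>\<close> and convergence\<close>

text \<open>At \<open>\<i>\<close> the modulus dominates both outer coefficients, and these determine the form up to
  the sign of \<open>b\<close>, so the sum over forms is dominated by a double zeta series.\<close>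

lemma norm_form_eval_i:
  assumes "(a, b, c) \<in> forms D"
  shows "real_of_int \<bar>a\<bar> * real_of_int \<bar>c\<bar> \<le> norm (form_eval (a, b, c) \<i> 1) ^ 2"
proof -
  have D: "b^2 - 4 * a * c > 0"
    using assms D_pos by (auto simp: forms_def)
  have ev: "norm (form_eval (a, b, c) \<i> 1) ^ 2 = real_of_int ((c - a)^2 + b^2)"
    by (simp add: cmod_power2)
  have "\<bar>a\<bar> * \<bar>c\<bar> = \<bar>a * c\<bar>"
    by (simp add: abs_mult)
  \<comment> \<open>For \<open>a * c \<ge> 0\<close>, positivity of \<open>D\<close> gives
    \<open>b^2 > 4 * a * c\<close>; otherwise the cross term \<open>- 2 * a * c\<close> of the
    square suffices.\<close>
  also have "\<dots> \<le> (c - a)^2 + b^2"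
  proof (cases "a * c \<ge> 0")
    case True
    have "(c - a)^2 \<ge> 0" by simp
    with True D show ?thesis by linarith
  next
    case False
    have "(c - a)^2 = a^2 + c^2 - 2 * (a * c)"
      by (simp add: power2_eq_square algebra_simps)
    moreover have "a^2 \<ge> 0" "c^2 \<ge> 0" "b^2 \<ge> 0" by auto
    ultimately show ?thesis using False by linarith
  qed
  finally show ?thesis
    unfolding ev by (metis of_int_le_iff of_int_mult)
qed

lemma summable_on_norm_form_eval_i_powr:
  assumes s: "s < -2"
  shows "(\<lambda>Q. norm (form_eval Q \<i> 1) powr s) summable_on forms D"
proof -
  \<comment> \<open>The squared modulus dominates \<open>\<bar>a\<bar> * \<bar>c\<bar>\<close>,
    which halves the exponent; \<open>s / 2 < -1\<close> still makes each single sum converge. As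
    \<open>0 powr x = 0\<close>, pairs with a zero entry contribute nothing.\<close>
  define g :: "int \<times> int \<Rightarrow> real" where
    "g = (\<lambda>(a, c). of_int \<bar>a\<bar> powr (s / 2) * of_int \<bar>c\<bar> powr (s / 2))"
  have one: "(\<lambda>n::int. of_int \<bar>n\<bar> powr (s / 2)) summable_on UNIV"
    using s by (intro summable_on_abs_int_powr) simp
  have "g summable_on (SIGMA a:UNIV. UNIV)"
  proof (rule summable_on_SigmaI)
    show "((\<lambda>c. g (a, c)) has_sum
            of_int \<bar>a\<bar> powr (s / 2) * (\<Sum>\<^sub>\<infinity>n. real_of_int \<bar>n\<bar> powr (s / 2))) UNIV" for a
      unfolding g_def using has_sum_infsum[OF one] by (auto intro: has_sum_cmult_right)
    show "(\<lambda>a. real_of_int \<bar>a\<bar> powr (s / 2) * (\<Sum>\<^sub>\<infinity>n. real_of_int \<bar>n\<bar> powr (s / 2))) summable_on UNIV"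
      using one by (rule summable_on_cmult_left)
  qed (auto simp: g_def)
  then have g: "g summable_on h ` B" for h :: "bqf \<Rightarrow> int \<times> int" and B
    by (rule summable_on_subset) auto
  have g': "(\<lambda>(a, b, c). g (a, c)) summable_on B" if "inj_on (\<lambda>(a, b, c). (a, c)) B" for B :: "bqf set"
    using g[of "\<lambda>(a, b, c). (a, c)" B] summable_on_reindex[OF that, of g]
    by (simp add: o_def case_prod_unfold)
  \<comment> \<open>With \<open>r = 4 * a * c\<close>, equal outer coefficients force equal squares
    of \<open>b\<close>; fixing the sign of \<open>b\<close> then makes the projection to
    \<open>(a, c)\<close> injective on each half.\<close>
  have sq: "b = b'" if "b^2 - r = D" "b'^2 - r = D" "b \<ge> 0 \<longleftrightarrow> b' \<ge> 0" for b b' r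
    using that power2_eq_iff[of b b'] by auto
  have "inj_on (\<lambda>(a, b, c). (a, c)) (forms D \<inter> {(a, b, c). b \<ge> 0})"
       "inj_on (\<lambda>(a, b, c). (a, c)) (forms D \<inter> {(a, b, c). b < 0})"
    by (auto simp: inj_on_def forms_def intro: sq)
  from summable_on_union[OF this[THEN g']]
  have "(\<lambda>(a, b, c). g (a, c)) summable_on forms D"
    by (rule back_subst[of "\<lambda>X. _ summable_on X"]) auto
  then show ?thesis
  proof (rule summable_on_comparison_test)
    fix Q assume "Q \<in> forms D"
    then obtain a b c where Q: "Q = (a, b, c)" and F: "(a, b, c) \<in> forms D"
      by (cases Q) auto
    have nz: "a \<noteq> 0" "c \<noteq> 0"
      using forms_nonzero F by auto
    have pos: "norm (form_eval Q \<i> 1) > 0"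
      using form_eval_nonzero[of Q \<i>] F Q by simp
    have "norm (form_eval Q \<i> 1) powr s = (norm (form_eval Q \<i> 1) powr 2) powr (s / 2)"
      unfolding powr_powr by simp
    also have "norm (form_eval Q \<i> 1) powr 2 = norm (form_eval Q \<i> 1) ^ 2"
      using pos by simp
    also have "(norm (form_eval Q \<i> 1) ^ 2) powr (s / 2) \<le> (real_of_int \<bar>a\<bar> * real_of_int \<bar>c\<bar>) powr (s / 2)"
      using nz s norm_form_eval_i[OF F] by (intro powr_mono2') (auto simp: Q)
    also have "\<dots> = (case Q of (a, b, c) \<Rightarrow> g (a, c))"
      by (simp add: Q g_def powr_mult)
    finally show "norm (form_eval Q \<i> 1) powr s \<le> (case Q of (a, b, c) \<Rightarrow> g (a, c))" .
  qed auto
qed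

text \<open>Moving a point from \<open>\<i>\<close> to \<open>z\<close> changes its distance to any
  real root by a factor bounded only in terms of \<open>R\<close> and \<open>\<delta>\<close>. Each
  of the two linear factors costs \<open>sqrt K\<close>.\<close>

lemma norm_form_eval_i_le:
  assumes Q: "Q \<in> forms D" and z: "\<bar>Re z\<bar> \<le> R" "\<delta> \<le> Im z" "\<delta> > 0"
  shows "norm (form_eval Q \<i> 1) \<le> (2 + (1 + 2 * R^2) / \<delta>^2) * norm (form_eval Q z 1)"
proof -
  \<comment> \<open>\<open>K - 2\<close> is chosen so that \<open>(K - 2) * (Im z)^2\<close> absorbs
    \<open>1 + 2 * R^2\<close>, and the remaining 2 serves \<open>(Re z - r)^2\<close>.\<close>
  define K where "K = 2 + (1 + 2 * R^2) / \<delta>^2"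
  have K: "K \<ge> 2" "(K - 2) * \<delta>^2 = 1 + 2 * R^2"
    using z by (auto simp: K_def)
  have R: "(Re z)^2 \<le> R^2" and \<delta>: "\<delta>^2 \<le> (Im z)^2"
    using z abs_le_square_iff[of "Re z" R] by (auto intro: power_mono)
  have root: "norm (\<i> - of_real r) \<le> sqrt K * norm (z - of_real r)" for r
  proof -
    \<comment> \<open>This is \<open>(x - y)^2 \<le> 2 * x^2 + 2 * y^2\<close> with
      \<open>x = Re z\<close> and \<open>y = Re z - r\<close>.\<close>
    have "1 + r^2 \<le> 1 + 2 * (Re z - r)^2 + 2 * (Re z)^2"
      using zero_le_power2[of "2 * Re z - r"] by (simp add: power2_eq_square algebra_simps)
    also have "\<dots> \<le> 2 * (Re z - r)^2 + (1 + 2 * R^2)"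
      using R by simp
    also have "1 + 2 * R^2 \<le> (K - 2) * (Im z)^2"
      using K \<delta> by (metis diff_ge_0_iff_ge mult_left_mono)
    also have "2 * (Re z - r)^2 + (K - 2) * (Im z)^2 \<le> K * (Re z - r)^2 + K * (Im z)^2"
      using K by (intro add_mono mult_right_mono) auto
    finally have "1 + r^2 \<le> K * norm (z - of_real r)^2"
      by (simp add: cmod_power2 algebra_simps)
    then have "sqrt (1 + r^2) \<le> sqrt (K * norm (z - of_real r)^2)"
      by (rule real_sqrt_le_mono)
    then show ?thesis
      by (simp add: cmod_def real_sqrt_mult add.commute)
  qed
  obtain a b c where abc: "Q = (a, b, c)"
    by (cases Q) auto
  define r1 r2 where "r1 = root_minus D Q" and "r2 = root_plus D Q"
  have fac: "norm (form_eval Q z 1) = \<bar>of_int a\<bar> * norm (z - of_real r1) * norm (z - of_real r2)" for z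
    unfolding r1_def r2_def abc form_eval_factor[OF Q[unfolded abc]] by (simp add: norm_mult)
  have "norm (form_eval Q \<i> 1) \<le> \<bar>of_int a\<bar> * (sqrt K * norm (z - of_real r1)) * (sqrt K * norm (z - of_real r2))"
    unfolding fac using root K by (intro mult_mono) auto
  also have "\<dots> = (sqrt K * sqrt K) * norm (form_eval Q z 1)"
    unfolding fac by (simp only: mult_ac)
  also have "sqrt K * sqrt K = K"
    using K by simp
  finally show ?thesis
    by (simp add: K_def)
qed

text \<open>A summable bound that is uniform on a box. The exponent \<open>-5/2\<close> lies below
  \<open>-2\<close>, as summability requires, and above \<open>-m\<close>, so the power of
  \<open>p \<ge> 1\<close> may be weakened to it.\<close>

lemma norm_inverse_form_eval_le:
  assumes Q: "Q \<in> forms D" and z: "\<bar>Re z\<bar> \<le> R" "\<delta> \<le> Im z" "\<delta> > 0" and m: "m \<ge> 3"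
  shows "inverse (norm (form_eval Q z 1)) ^ m \<le>
           (2 + (1 + 2 * R^2) / \<delta>^2) ^ m * norm (form_eval Q \<i> 1) powr (-5/2)"
proof -
  define K where "K = 2 + (1 + 2 * R^2) / \<delta>^2"
  define p q where "p = norm (form_eval Q \<i> 1)" and "q = norm (form_eval Q z 1)"
  have q: "q > 0"
    using form_eval_nonzero[OF Q, of z] z by (simp add: q_def)
  have p: "p \<ge> 1"
    using norm_form_eval_ge_Im[OF Q, of \<i>] by (simp add: p_def)
  have pq: "p \<le> K * q"
    unfolding p_def q_def K_def using Q z by (rule norm_form_eval_i_le)
  have "inverse q ^ m \<le> (K * inverse p) ^ m"
    using p q pq by (intro power_mono) (auto simp: field_simps)
  also have "\<dots> = K ^ m * p powr (- real m)"
    using p by (simp add: power_mult_distrib powr_minus powr_realpow power_inverse)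
  also have "\<dots> \<le> K ^ m * p powr (-5/2)"
    using p m by (intro mult_left_mono powr_mono) (auto simp: K_def)
  finally show ?thesis
    by (simp add: K_def p_def q_def)
qed

text \<open>The spare half power beyond \<open>5/2\<close> yields decay at the cusp.\<close>

lemma norm_inverse_form_eval_decay:
  assumes Q: "Q \<in> forms D" and z: "\<bar>Re z\<bar> \<le> 1" "1 \<le> Im z" and m: "m \<ge> 3"
  shows "inverse (norm (form_eval Q z 1)) ^ m \<le>
           5 powr (5/2) * norm (form_eval Q \<i> 1) powr (-5/2) / Im z"
proof -
  define p q where "p = norm (form_eval Q \<i> 1)" and "q = norm (form_eval Q z 1)"
  have q: "q \<ge> (Im z)^2"
    using norm_form_eval_ge_Im[OF Q] by (simp add: q_def)
  moreover have "(Im z)^2 \<ge> 1"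
    using z by simp
  ultimately have q1: "q \<ge> 1"
    by linarith
  have p: "p \<ge> 1"
    using norm_form_eval_ge_Im[OF Q, of \<i>] by (simp add: p_def)
  \<comment> \<open>The constant is \<open>2 + (1 + 2 * R^2) / \<delta>^2\<close> at
    \<open>R = \<delta> = 1\<close>.\<close>
  have pq: "p \<le> 5 * q"
    using norm_form_eval_i_le[OF Q z] by (simp add: p_def q_def)
  have "inverse q ^ m = q powr (- real m)"
    using q1 by (simp add: powr_minus powr_realpow power_inverse)
  also have "\<dots> \<le> q powr (-1/2 + -5/2)"
    using q1 m by (intro powr_mono) auto
  also have "\<dots> = q powr (-1/2) * q powr (-5/2)"
    by (rule powr_add)
  \<comment> \<open>The half power is bounded by \<open>q \<ge> (Im z)^2\<close>, the remaining
    power by \<open>q \<ge> p / 5\<close>.\<close>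
  also have "\<dots> \<le> ((Im z)^2) powr (-1/2) * (p / 5) powr (-5/2)"
    using q pq p z by (intro mult_mono powr_mono2') auto
  also have "((Im z)^2) powr (-1/2) = inverse (Im z)"
    using z by (simp add: powr_minus powr_half_sqrt)
  also have "(p / 5) powr (-5/2) = 5 powr (5/2) * p powr (-5/2)"
    using p by (simp add: powr_divide powr_minus field_simps)
  finally show ?thesis
    by (simp add: p_def q_def field_simps)
qed

section \<open>Series over forms with bounded coefficients\<close>

definition majorant :: "nat \<Rightarrow> complex \<Rightarrow> real" where
  "majorant m z = (\<Sum>\<^sub>\<infinity>Q\<in>forms D. inverse (norm (form_eval Q z 1)) ^ m)"

lemma summable_on_norm_inverse_form_eval:
  assumes "Im z > 0" "m \<ge> 3"
  shows "(\<lambda>Q. inverse (norm (form_eval Q z 1)) ^ m) summable_on forms D"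
proof (rule summable_on_comparison_test)
  show "(\<lambda>Q. (2 + (1 + 2 * \<bar>Re z\<bar>^2) / (Im z)^2) ^ m * norm (form_eval Q \<i> 1) powr (-5/2))
          summable_on forms D"
    by (intro summable_on_cmult_right summable_on_norm_form_eval_i_powr) simp
next
  fix Q assume "Q \<in> forms D"
  then show "inverse (norm (form_eval Q z 1)) ^ m \<le>
      (2 + (1 + 2 * \<bar>Re z\<bar>^2) / (Im z)^2) ^ m * norm (form_eval Q \<i> 1) powr (-5/2)"
    using assms by (intro norm_inverse_form_eval_le) simp_all
qed simp

lemma norm_term_le:
  assumes "norm c \<le> C"
  shows "norm (c / form_eval Q z 1 ^ m) \<le> C * inverse (norm (form_eval Q z 1)) ^ m"
proof -
  have "norm (c / form_eval Q z 1 ^ m) = norm c * inverse (norm (form_eval Q z 1)) ^ m"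
    unfolding norm_divide norm_power power_inverse by (rule divide_inverse)
  with assms show ?thesis
    by (simp add: mult_right_mono)
qed

text \<open>All series in \<open>Omega\<close> have this shape: logarithms at a fixed non-real
  point, signs and arctangents are bounded uniformly over the forms.\<close>

lemma summable_on_bounded_div:
  assumes "Im z > 0" "m \<ge> 3" and "\<And>Q. Q \<in> forms D \<Longrightarrow> norm (c Q) \<le> C"
  shows "(\<lambda>Q. c Q / form_eval Q z 1 ^ m) summable_on forms D"
  unfolding summable_on_iff_abs_summable_on_complex
proof (rule Infinite_Sum.abs_summable_on_comparison_test')
  show "(\<lambda>Q. C * inverse (norm (form_eval Q z 1)) ^ m) summable_on forms D"
    using assms by (intro summable_on_cmult_right summable_on_norm_inverse_form_eval)
qed (use assms in \<open>simp only: norm_term_le\<close>)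

lemma norm_infsum_bounded_div_le:
  assumes "Im z > 0" "m \<ge> 3" and "\<And>Q. Q \<in> forms D \<Longrightarrow> norm (c Q) \<le> C"
  shows "norm (\<Sum>\<^sub>\<infinity>Q\<in>forms D. c Q / form_eval Q z 1 ^ m) \<le> C * majorant m z"
proof (rule norm_infsum_le)
  show "((\<lambda>Q. c Q / form_eval Q z 1 ^ m) has_sum (\<Sum>\<^sub>\<infinity>Q\<in>forms D. c Q / form_eval Q z 1 ^ m)) (forms D)"
    using summable_on_bounded_div[OF assms] by (rule has_sum_infsum)
  show "((\<lambda>Q. C * inverse (norm (form_eval Q z 1)) ^ m) has_sum (C * majorant m z)) (forms D)"
    unfolding majorant_def
    by (intro has_sum_cmult_right has_sum_infsum summable_on_norm_inverse_form_eval assms)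
qed (use assms in \<open>simp add: norm_term_le\<close>)

section \<open>Translation and inversion acting on forms\<close>

fun translate :: "int \<Rightarrow> bqf \<Rightarrow> bqf" where
  "translate n (a, b, c) = (a, b + 2 * n * a, a * n^2 + b * n + c)"

text \<open>\<open>invert Q\<close> is the form \<open>Q(-y, x)\<close>, and
  \<open>translate n Q\<close> is \<open>Q(x + n * y, y)\<close>: the actions of inversion and
  translation in the modular group.\<close>

fun invert :: "bqf \<Rightarrow> bqf" where
  "invert (a, b, c) = (c, - b, a)"

lemma translate_in_forms: "Q \<in> forms D \<Longrightarrow> translate n Q \<in> forms D"
  by (cases Q) (auto simp: forms_def power2_eq_square algebra_simps)

lemma translate_translate: "translate (- n) (translate n Q) = Q" "translate n (translate (- n) Q) = Q"
  by (cases Q, simp add: power2_eq_square algebra_simps)+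

lemma invert_in_forms: "Q \<in> forms D \<Longrightarrow> invert Q \<in> forms D"
  by (cases Q) (auto simp: forms_def algebra_simps)

lemma invert_invert: "invert (invert Q) = Q"
  by (cases Q) simp

lemma infsum_forms_translate:
  "(\<Sum>\<^sub>\<infinity>Q\<in>forms D. f (translate n Q)) = (\<Sum>\<^sub>\<infinity>Q\<in>forms D. f Q)"
  by (rule infsum_reindex_bij_witness[where i = "translate (- n)" and j = "translate n"])
     (auto simp: translate_translate translate_in_forms)

lemma infsum_forms_invert:
  "(\<Sum>\<^sub>\<infinity>Q\<in>forms D. f (invert Q)) = (\<Sum>\<^sub>\<infinity>Q\<in>forms D. f Q)"
  by (rule infsum_reindex_bij_witness[where i = invert and j = invert])
     (auto simp: invert_invert invert_in_forms)

lemma form_eval_translate: "form_eval Q (z + of_int n) 1 = form_eval (translate n Q) z 1"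
  by (cases Q) (simp add: power2_eq_square algebra_simps)

lemma form_eval_invert:
  assumes "z \<noteq> 0"
  shows "form_eval Q (- 1 / z) 1 = form_eval (invert Q) z 1 / z^2"
  using assms by (cases Q) (simp add: power2_eq_square field_simps)

lemma majorant_translate: "majorant m (z + of_int n) = majorant m z"
  unfolding majorant_def form_eval_translate
  by (rule infsum_forms_translate)

text \<open>The decay estimate for single forms needs a bounded real part. Periodicity of the
  majorant moves \<open>z\<close> into a strip of width 1, so \<open>C\<close> does not depend on
  \<open>Re z\<close>, which is unrestricted in the limit.\<close>

lemma majorant_decay:
  assumes m: "m \<ge> 3"
  obtains C where "C \<ge> 0" "\<And>z. Im z \<ge> 1 \<Longrightarrow> majorant m z \<le> C / Im z"
proof
  define C where "C = 5 powr (5/2) * (\<Sum>\<^sub>\<infinity>Q\<in>forms D. norm (form_eval Q \<i> 1) powr (-5/2))"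
  show "C \<ge> 0"
    unfolding C_def by (intro mult_nonneg_nonneg infsum_nonneg) auto
  show "majorant m z \<le> C / Im z" if z: "Im z \<ge> 1" for z
  proof -
    define z' where "z' = z + of_int (- \<lfloor>Re z\<rfloor>)"
    have z': "\<bar>Re z'\<bar> \<le> 1" "Im z' = Im z"
      unfolding z'_def using floor_correct[of "Re z"] by simp_all linarith
    have "majorant m z = majorant m z'"
      unfolding z'_def by (rule majorant_translate[symmetric])
    also have "\<dots> \<le> C / Im z'"
    proof -
      have up: "((\<lambda>Q. 5 powr (5/2) * norm (form_eval Q \<i> 1) powr (-5/2) / Im z') has_sum C / Im z') (forms D)"
        unfolding C_def
        by (intro has_sum_divide_const has_sum_cmult_right has_sum_infsum
            summable_on_norm_form_eval_i_powr) simp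
      have lo: "((\<lambda>Q. inverse (norm (form_eval Q z' 1)) ^ m) has_sum majorant m z') (forms D)"
        unfolding majorant_def using z z' m
        by (intro has_sum_infsum summable_on_norm_inverse_form_eval) auto
      show ?thesis
        by (rule has_sum_mono[OF lo up]) (use z z' m in \<open>intro norm_inverse_form_eval_decay, simp_all\<close>)
    qed
    finally show ?thesis
      using z' by simp
  qed
qed

section \<open>The logarithm attached to a form\<close>

definition root_log :: "bqf \<Rightarrow> complex \<Rightarrow> complex" where
  "root_log Q z = Ln ((z - of_real (root_minus D Q)) / (z - of_real (root_plus D Q)))"

text \<open>A real value \<open>r\<close> of the quotient must be 1 by comparing imaginary parts,
  and then the two roots coincide. Hence the quotient avoids the branch cut of \<open>Ln\<close> on
  both half-planes.\<close>

lemma root_quotient_not_real: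
  assumes Q: "Q \<in> forms D" and z: "Im z \<noteq> 0"
  shows "(z - of_real (root_minus D Q)) / (z - of_real (root_plus D Q)) \<notin> \<real>"
proof
  assume "(z - of_real (root_minus D Q)) / (z - of_real (root_plus D Q)) \<in> \<real>"
  then obtain r where r: "(z - of_real (root_minus D Q)) / (z - of_real (root_plus D Q)) = of_real r"
    by (auto elim: Reals_cases)
  have "z - of_real (root_plus D Q) \<noteq> 0"
    using z by (auto simp: complex_eq_iff)
  then have eq: "z - of_real (root_minus D Q) = of_real r * (z - of_real (root_plus D Q))"
    using r by (simp add: field_simps)
  from arg_cong[OF eq, of Im] have "r = 1"
    using z by simp
  with eq root_distance(2)[OF Q] show False
    by simp
qed

lemma root_log_cnj:
  assumes "Q \<in> forms D" "Im z \<noteq> 0"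
  shows "root_log Q (cnj z) = cnj (root_log Q z)"
proof -
  have "(z - of_real (root_minus D Q)) / (z - of_real (root_plus D Q)) \<notin> \<real>\<^sub>\<le>\<^sub>0"
    using root_quotient_not_real[OF assms] nonpos_Reals_subset_Reals by blast
  from cnj_Ln[OF this] show ?thesis
    by (simp add: root_log_def)
qed

lemma norm_root_log_le:
  assumes "Q \<in> forms D" "Im z \<noteq> 0"
  shows "norm (root_log Q z) \<le> pi + sqrt (of_int D) / \<bar>Im z\<bar>"
  unfolding root_log_def
proof (rule norm_Ln_divide_le)
  show "\<bar>Im z\<bar> \<le> norm (z - of_real (root_minus D Q))" "\<bar>Im z\<bar> \<le> norm (z - of_real (root_plus D Q))"
    using abs_Im_le_cmod[of "z - of_real (root_minus D Q)"] abs_Im_le_cmod[of "z - of_real (root_plus D Q)"]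
    by simp_all
  show "norm (z - of_real (root_minus D Q) - (z - of_real (root_plus D Q))) \<le> sqrt (of_int D)"
    using root_distance(1)[OF assms(1)] by (simp flip: of_real_diff)
qed (use assms in simp)

lemma norm_root_log_le_small:
  assumes "Q \<in> forms D" "2 * sqrt (of_int D) < \<bar>Im z\<bar>"
  shows "norm (root_log Q z) \<le> 2 * sqrt (of_int D) / \<bar>Im z\<bar>"
  unfolding root_log_def
proof (rule norm_Ln_divide_le_small)
  show "\<bar>Im z\<bar> \<le> norm (z - of_real (root_plus D Q))"
    using abs_Im_le_cmod[of "z - of_real (root_plus D Q)"] by simp
  show "norm (z - of_real (root_minus D Q) - (z - of_real (root_plus D Q))) \<le> sqrt (of_int D)"
    using root_distance(1)[OF assms(1)] by (simp flip: of_real_diff)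
qed (use assms in simp)

text \<open>The logarithmic derivative of the quotient is
  \<open>(r1 - r2) / ((z - r1) * (z - r2))\<close>, and \<open>r1 - r2 = - sqrt D / a\<close>
  supplies the leading coefficient missing from the denominator.\<close>

lemma has_field_derivative_root_log:
  assumes Q: "Q \<in> forms D" and z: "Im z \<noteq> 0"
  shows "(root_log Q has_field_derivative - of_real (sqrt (of_int D)) / form_eval Q z 1) (at z)"
proof -
  obtain a b c where abc: "Q = (a, b, c)"
    by (cases Q) auto
  define r1 r2 :: complex where "r1 = of_real (root_minus D Q)" and "r2 = of_real (root_plus D Q)"
  have nz: "z - r1 \<noteq> 0" "z - r2 \<noteq> 0"
    using z by (auto simp: r1_def r2_def complex_eq_iff)
  have a: "a \<noteq> 0"
    using forms_nonzero Q abc by auto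
  have "r2 - r1 = of_real (sqrt (of_int D) / of_int a)"
    unfolding r1_def r2_def abc of_real_diff[symmetric] root_plus_minus_root_minus ..
  then have diff: "r1 - r2 = - of_real (sqrt (of_int D)) / of_int a"
    by (simp add: algebra_simps)
  have quot: "(z - r1) / (z - r2) \<notin> \<real>\<^sub>\<le>\<^sub>0"
    using root_quotient_not_real[OF Q z] nonpos_Reals_subset_Reals by (auto simp: r1_def r2_def)
  have "((\<lambda>z. Ln ((z - r1) / (z - r2))) has_field_derivative
          (((z - r2) - (z - r1)) / ((z - r2) * (z - r2))) / ((z - r1) / (z - r2))) (at z)"
    using nz quot by (auto intro!: derivative_eq_intros)
  also have "(((z - r2) - (z - r1)) / ((z - r2) * (z - r2))) / ((z - r1) / (z - r2)) =
               (r1 - r2) / ((z - r1) * (z - r2))"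
    using nz by (simp add: divide_simps)
  also have "\<dots> = - of_real (sqrt (of_int D)) / form_eval Q z 1"
    unfolding diff abc form_eval_factor[OF Q[unfolded abc]] using a
    by (simp add: r1_def r2_def abc mult.assoc)
  finally show ?thesis
    unfolding root_log_def r1_def r2_def .
qed

lemma holomorphic_root_log:
  assumes "Q \<in> forms D"
  shows "root_log Q holomorphic_on upper_half_plane"
  unfolding holomorphic_on_def upper_half_plane_def
proof
  fix z assume "z \<in> {z. Im z > 0}"
  then show "root_log Q field_differentiable at z within {z. Im z > 0}"
    using has_field_derivative_root_log[OF assms, of z] field_differentiable_at_within
    by (fastforce simp: field_differentiable_def)
qed

text \<open>Both roots move by \<open>-1\<close>, so the argument of \<open>Ln\<close> is literally
  the same and no branch question arises.\<close>

lemma root_log_translate: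
  assumes "Q \<in> forms D"
  shows "root_log Q (z + 1) = root_log (translate 1 Q) z"
proof -
  obtain a b c where abc: "Q = (a, b, c)"
    by (cases Q) auto
  have "a \<noteq> 0"
    using forms_nonzero assms abc by auto
  then have roots: "root_minus D (translate 1 Q) = root_minus D Q - 1"
                   "root_plus D (translate 1 Q) = root_plus D Q - 1"
    by (simp_all add: abc field_simps)
  show ?thesis
    unfolding root_log_def roots by (simp add: algebra_simps)
qed

lemma Im_minus_inverse: "Im (- 1 / z) = Im z / (norm z)^2"
  by (simp add: Im_divide cmod_power2)

text \<open>Both sides have the same derivative in \<open>\<tau>\<close>, which avoids tracking branches of the logarithm.\<close>

lemma root_log_diff_invert:
  assumes Q: "Q \<in> forms D" and \<tau>: "Im \<tau> > 0" and v: "Im v > 0"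
  shows "root_log Q (- 1 / \<tau>) - root_log Q (- 1 / v) = root_log (invert Q) \<tau> - root_log (invert Q) v"
proof -
  define s :: complex where "s = of_real (sqrt (of_int D))"
  \<comment> \<open>The constant depends on the branches and need not vanish; it cancels between
    \<open>\<tau>\<close> and \<open>v\<close>, which is why only differences of logarithms are
    equivariant.\<close>
  have "\<exists>c. \<forall>z\<in>{z. Im z > 0}. root_log Q (- 1 / z) - root_log (invert Q) z = c"
  proof (rule has_field_derivative_zero_constant)
    show "convex {z. Im z > 0}"
      by (rule convex_halfspace_Im_gt)
    fix z assume "z \<in> {z. Im z > 0}"
    then have z: "Im z > 0" "z \<noteq> 0"
      by auto
    have "Im (- 1 / z) \<noteq> 0"
      using z unfolding Im_minus_inverse by simp
    from has_field_derivative_root_log[OF Q this]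
    have "((\<lambda>z. root_log Q (- 1 / z)) has_field_derivative
            - s / form_eval Q (- 1 / z) 1 * (1 / z^2)) (at z)"
      unfolding s_def
      by (rule DERIV_chain2)
         (use z in \<open>auto intro!: derivative_eq_intros simp: power2_eq_square\<close>)
    \<comment> \<open>The chain rule factor \<open>1 / z^2\<close> cancels the automorphy factor of
      the form.\<close>
    also have "- s / form_eval Q (- 1 / z) 1 * (1 / z^2) = - s / form_eval (invert Q) z 1"
      unfolding form_eval_invert[OF z(2)] using z by simp
    finally have "((\<lambda>z. root_log Q (- 1 / z) - root_log (invert Q) z) has_field_derivative 0) (at z)"
      using has_field_derivative_root_log[OF invert_in_forms[OF Q], of z] z
      unfolding s_def by (auto intro: derivative_eq_intros)
    then show "((\<lambda>z. root_log Q (- 1 / z) - root_log (invert Q) z) has_field_derivative 0)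
                 (at z within {z. Im z > 0})"
      by (rule has_field_derivative_at_within)
  qed
  then have "root_log Q (- 1 / \<tau>) - root_log (invert Q) \<tau> = root_log Q (- 1 / v) - root_log (invert Q) v"
    using \<tau> v by auto
  then show ?thesis
    by (simp add: algebra_simps)
qed

text \<open>With \<open>t = form_at Q w / sqrt D\<close>, the root quotient is a positive multiple
  of \<open>sgn a * \<i> * (1 + \<i> * t)\<close>. The argument of \<open>1 + \<i> * t\<close> is
  \<open>arctan t\<close>, and \<open>sgn a * \<i>\<close> contributes
  \<open>sgn a * pi / 2\<close>.\<close>

lemma Im_root_log_lower:
  assumes Q: "Q \<in> forms D" and w: "Im w < 0"
  shows "Im (root_log Q w) =
           arctan (form_at Q w / sqrt (of_int D)) + of_int (form_sgn Q) * pi / 2"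
proof -
  obtain a b c where abc: "Q = (a, b, c)"
    by (cases Q) auto
  have a: "a \<noteq> 0" and disc: "D = b^2 - 4 * a * c"
    using forms_nonzero Q abc by (auto simp: forms_def)
  define s t r1 r2 where "s = sqrt (of_int D)" and "t = form_at Q w / s"
    and "r1 = root_minus D Q" and "r2 = root_plus D Q"
  have s: "s > 0" "s^2 = of_int b^2 - 4 * of_int a * of_int c"
    using D_pos by (simp_all add: s_def) (simp add: disc)
  have nz: "w - of_real r2 \<noteq> 0"
    using w by (auto simp: complex_eq_iff)
  \<comment> \<open>This is the positive factor left after clearing the denominator by its
    conjugate; \<open>Im w < 0\<close> turns \<open>Im w / a\<close> into
    \<open>- sgn a * \<bar>Im w\<bar> / \<bar>a\<bar>\<close>.\<close>
  define \<kappa> where "\<kappa> = s * \<bar>Im w\<bar> / (\<bar>of_int a\<bar> * (norm (w - of_real r2))^2)"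
  have \<kappa>: "\<kappa> > 0"
    unfolding \<kappa>_def using s a w nz by (intro divide_pos_pos mult_pos_pos) auto
  have sum: "r1 + r2 = - of_int b / of_int a"
    using a unfolding r1_def r2_def abc by (simp add: field_simps)
  have "r1 * r2 = (of_int b^2 - s^2) / (2 * of_int a * (2 * of_int a))"
    unfolding r1_def r2_def abc root_plus.simps root_minus.simps s_def
    by (simp add: power2_eq_square algebra_simps)
  also have "\<dots> = of_int c / of_int a"
    unfolding s(2) using a by (simp add: field_simps)
  finally have prod: "r1 * r2 = of_int c / of_int a" .
  have diff: "r2 - r1 = s / of_int a"
    unfolding r1_def r2_def abc root_plus_minus_root_minus s_def ..
  have conj_prod: "(w - of_real r1) * cnj (w - of_real r2) =
          of_real (Im w / of_int a) * (of_real (form_at Q w) - \<i> * of_real s)"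
  proof (rule complex_eqI)
    have "Re ((w - of_real r1) * cnj (w - of_real r2)) = (norm w)^2 - (r1 + r2) * Re w + r1 * r2"
      unfolding cmod_power2 by (simp add: power2_eq_square algebra_simps)
    also have "\<dots> = Im w / of_int a * form_at Q w"
      unfolding sum prod abc form_at.simps using a w by (simp add: field_simps)
    finally show "Re ((w - of_real r1) * cnj (w - of_real r2)) =
        Re (of_real (Im w / of_int a) * (of_real (form_at Q w) - \<i> * of_real s))"
      by simp
    have "Im ((w - of_real r1) * cnj (w - of_real r2)) = - (r2 - r1) * Im w"
      by (simp add: algebra_simps)
    also have "\<dots> = - (Im w / of_int a) * s"
      unfolding diff by simp
    finally show "Im ((w - of_real r1) * cnj (w - of_real r2)) =
        Im (of_real (Im w / of_int a) * (of_real (form_at Q w) - \<i> * of_real s))"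
      by simp
  qed
  have "(w - of_real r1) / (w - of_real r2) =
          (w - of_real r1) * cnj (w - of_real r2) / of_real ((norm (w - of_real r2))^2)"
    by (rule complex_div_cnj)
  also have "\<dots> = of_real (\<kappa> * of_int (sgn a)) * \<i> * (1 + \<i> * of_real t)"
    unfolding conj_prod \<kappa>_def t_def using a w s nz
    by (cases "a > 0") (simp_all add: field_simps)
  also have "1 + \<i> * of_real t = of_real (sqrt (1 + t^2)) * exp (\<i> * of_real (arctan t))"
    using add_pos_nonneg[OF zero_less_one zero_le_power2, of t]
    by (simp add: exp_Euler cos_of_real sin_of_real cos_arctan sin_arctan field_simps)
  finally have z: "(w - of_real r1) / (w - of_real r2) =
      of_real (\<kappa> * sqrt (1 + t^2)) * (of_int (sgn a) * \<i> * exp (\<i> * of_real (arctan t)))"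
    by (simp add: mult_ac)
  have "of_int (sgn a) * \<i> = exp (\<i> * of_real (of_int (sgn a) * pi / 2))"
    unfolding cis_conv_exp[symmetric] using a by (cases "a > 0") simp_all
  then have pol: "of_real (\<kappa> * sqrt (1 + t^2)) * exp (\<i> * of_real (arctan t + of_int (sgn a) * pi / 2)) =
      (w - of_real r1) / (w - of_real r2)"
    unfolding z by (simp add: exp_add ring_distribs mult_ac)
  have pos: "\<kappa> * sqrt (1 + t^2) > 0"
    using \<kappa> by (simp add: add_pos_nonneg)
  \<comment> \<open>Since \<open>arctan t\<close> lies strictly between \<open>- pi / 2\<close> and
    \<open>pi / 2\<close>, the sum stays within the principal range and no multiple of
    \<open>2 * pi\<close> has to be corrected.\<close>
  have "Arg ((w - of_real r1) / (w - of_real r2)) = arctan t + of_int (sgn a) * pi / 2"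
    using pol pos
  proof (rule Arg_unique)
    show "- pi < arctan t + of_int (sgn a) * pi / 2" "arctan t + of_int (sgn a) * pi / 2 \<le> pi"
      using a arctan_bounded[of t] by (cases "a > 0"; simp; linarith)+
  qed
  moreover have "(w - of_real r1) / (w - of_real r2) \<noteq> 0"
    using pol pos by (metis exp_not_eq_zero mult_eq_0_iff of_real_eq_0_iff less_irrefl)
  ultimately show ?thesis
    by (simp add: root_log_def Arg_eq_Im_Ln r1_def r2_def t_def s_def abc)
qed

section \<open>Properties of \<open>\<Omega>\<close>\<close>

text \<open>All four series converge because their coefficients are uniformly bounded, so they may
  be combined term by term.\<close>

lemma Omega_eq:
  assumes m: "m \<ge> 3" and \<tau>: "Im \<tau> > 0" and w: "Im w < 0"
  shows "Omega m D \<tau> w =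
           (\<Sum>\<^sub>\<infinity>Q\<in>forms D. (root_log Q \<tau> - root_log Q (cnj w)) / form_eval Q \<tau> 1 ^ m)"
proof -
  define t where "t = (\<lambda>Q. arctan (form_at Q w / sqrt (of_int D)))"
  note has_sum_div = has_sum_infsum[OF summable_on_bounded_div[OF \<tau> m]]
  have psi: "((\<lambda>Q. root_log Q \<tau> / form_eval Q \<tau> 1 ^ m) has_sum psi m D \<tau>) (forms D)"
    unfolding psi_def root_log_def[symmetric]
    by (rule has_sum_div) (use norm_root_log_le[of _ \<tau>] \<tau> in simp)
  have rho: "((\<lambda>Q. root_log Q w / form_eval Q \<tau> 1 ^ m) has_sum rho m D \<tau> w) (forms D)"
    unfolding rho_def root_log_def[symmetric]
    by (rule has_sum_div) (use norm_root_log_le[of _ w] w in simp)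
  have phi: "((\<lambda>Q. 1/2 * (of_int (form_sgn Q) / form_eval Q \<tau> 1 ^ m)) has_sum phi m D \<tau>) (forms D)"
    unfolding phi_def
  proof (rule has_sum_cmult_right, rule has_sum_div)
    show "norm (of_int (form_sgn Q) :: complex) \<le> 1" for Q
      by (cases Q) (simp add: sgn_if)
  qed
  have lambda: "((\<lambda>Q. 2 * \<i> * (of_real (t Q) / form_eval Q \<tau> 1 ^ m)) has_sum lambda m D \<tau> w) (forms D)"
    unfolding lambda_def t_def
  proof (rule has_sum_cmult_right, rule has_sum_div)
    show "norm (of_real (arctan (form_at Q w / sqrt (of_int D))) :: complex) \<le> pi" for Q
      using arctan_bounded[of "form_at Q w / sqrt (of_int D)"] by (simp add: abs_le_iff)
  qed
  have "((\<lambda>Q. root_log Q \<tau> / form_eval Q \<tau> 1 ^ m - root_log Q w / form_eval Q \<tau> 1 ^ m +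
            2 * of_real pi * \<i> * (1/2 * (of_int (form_sgn Q) / form_eval Q \<tau> 1 ^ m)) +
            2 * \<i> * (of_real (t Q) / form_eval Q \<tau> 1 ^ m)) has_sum Omega m D \<tau> w) (forms D)"
    unfolding Omega_def diff_conv_add_uminus
    by (intro has_sum_add has_sum_uminusI has_sum_cmult_right psi rho phi lambda)
  \<comment> \<open>The terms of \<open>phi\<close> and \<open>lambda\<close> add up to
    \<open>2 * \<i> * Im (root_log Q w)\<close> over \<open>q\<close>, exactly what changes
    \<open>- root_log Q w\<close> into minus its conjugate.\<close>
  moreover have "root_log Q \<tau> / q - root_log Q w / q + 2 * of_real pi * \<i> * (1/2 * (of_int (form_sgn Q) / q)) +
      2 * \<i> * (of_real (t Q) / q) = (root_log Q \<tau> - root_log Q (cnj w)) / q"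
    if Q: "Q \<in> forms D" for Q q
  proof -
    have "root_log Q (cnj w) = root_log Q w - 2 * \<i> * of_real (Im (root_log Q w))"
      using root_log_cnj[OF Q, of w] w by (simp add: complex_eq_iff)
    also have "Im (root_log Q w) = t Q + of_int (form_sgn Q) * pi / 2"
      unfolding t_def by (rule Im_root_log_lower[OF Q w])
    finally have eq: "root_log Q (cnj w) = root_log Q w - 2 * \<i> * of_real (t Q + of_int (form_sgn Q) * pi / 2)" .
    show ?thesis
      unfolding eq by (simp add: diff_divide_distrib add_divide_distrib algebra_simps)
  qed
  ultimately have "((\<lambda>Q. (root_log Q \<tau> - root_log Q (cnj w)) / form_eval Q \<tau> 1 ^ m)
                      has_sum Omega m D \<tau> w) (forms D)"
    by (simp cong: has_sum_cong)
  then show ?thesis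
    by (rule infsumI[symmetric])
qed

section \<open>Bimodularity under the two generators\<close>

lemma Omega_translate:
  assumes m: "m \<ge> 3" and \<tau>: "Im \<tau> > 0" and w: "Im w < 0"
  shows "Omega m D (\<tau> + 1) (w + 1) = Omega m D \<tau> w"
proof -
  have "Omega m D (\<tau> + 1) (w + 1) =
        (\<Sum>\<^sub>\<infinity>Q\<in>forms D. (root_log Q (\<tau> + 1) - root_log Q (cnj w + 1)) / form_eval Q (\<tau> + 1) 1 ^ m)"
    using m \<tau> w by (subst Omega_eq) simp_all
  also have "\<dots> = (\<Sum>\<^sub>\<infinity>Q\<in>forms D. (root_log (translate 1 Q) \<tau> - root_log (translate 1 Q) (cnj w)) /
                    form_eval (translate 1 Q) \<tau> 1 ^ m)"
    using form_eval_translate[of _ \<tau> 1] by (intro infsum_cong) (simp add: root_log_translate)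
  also have "\<dots> = Omega m D \<tau> w"
    unfolding Omega_eq[OF m \<tau> w] by (rule infsum_forms_translate)
  finally show ?thesis .
qed

lemma Omega_invert:
  assumes m: "m \<ge> 3" and \<tau>: "Im \<tau> > 0" and w: "Im w < 0"
  shows "Omega m D (- 1 / \<tau>) (- 1 / w) = \<tau> ^ (2 * m) * Omega m D \<tau> w"
proof -
  have "\<tau> \<noteq> 0" "w \<noteq> 0"
    using \<tau> w by auto
  then have Im: "Im (- 1 / \<tau>) > 0" "Im (- 1 / w) < 0"
    unfolding Im_minus_inverse using \<tau> w by (simp_all add: divide_less_0_iff)
  have "Omega m D (- 1 / \<tau>) (- 1 / w) =
        (\<Sum>\<^sub>\<infinity>Q\<in>forms D. (root_log Q (- 1 / \<tau>) - root_log Q (cnj (- 1 / w))) / form_eval Q (- 1 / \<tau>) 1 ^ m)"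
    by (rule Omega_eq[OF m Im])
  also have "\<dots> = (\<Sum>\<^sub>\<infinity>Q\<in>forms D. \<tau> ^ (2 * m) *
        ((root_log (invert Q) \<tau> - root_log (invert Q) (cnj w)) / form_eval (invert Q) \<tau> 1 ^ m))"
  proof (rule infsum_cong)
    fix Q assume Q: "Q \<in> forms D"
    \<comment> \<open>The second point is \<open>- 1 / cnj w\<close>, and \<open>cnj w\<close> lies
      in the upper half-plane, so the equivariance of differences applies. The factor
      \<open>\<tau> ^ (2 * m)\<close> comes from the \<open>m\<close>-th power of the
      denominator.\<close>
    have "root_log Q (- 1 / \<tau>) - root_log Q (cnj (- 1 / w)) = root_log (invert Q) \<tau> - root_log (invert Q) (cnj w)"
      using root_log_diff_invert[OF Q \<tau>, of "cnj w"] w by simp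
    then show "(root_log Q (- 1 / \<tau>) - root_log Q (cnj (- 1 / w))) / form_eval Q (- 1 / \<tau>) 1 ^ m =
        \<tau> ^ (2 * m) * ((root_log (invert Q) \<tau> - root_log (invert Q) (cnj w)) / form_eval (invert Q) \<tau> 1 ^ m)"
      unfolding form_eval_invert[OF \<open>\<tau> \<noteq> 0\<close>] by (simp add: power_divide power_mult)
  qed
  also have "\<dots> = \<tau> ^ (2 * m) * Omega m D \<tau> w"
    unfolding Omega_eq[OF m \<tau> w] infsum_cmult_right' by (subst infsum_forms_invert) (rule refl)
  finally show ?thesis .
qed

section \<open>Limits at the cusps\<close>

lemma Omega_eq_psi_minus:
  assumes m: "m \<ge> 3" and \<tau>: "Im \<tau> > 0" and w: "Im w < 0"
  shows "Omega m D \<tau> w = psi m D \<tau> - (\<Sum>\<^sub>\<infinity>Q\<in>forms D. root_log Q (cnj w) / form_eval Q \<tau> 1 ^ m)"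
proof -
  have 1: "((\<lambda>Q. root_log Q \<tau> / form_eval Q \<tau> 1 ^ m) has_sum psi m D \<tau>) (forms D)"
    unfolding psi_def root_log_def[symmetric]
    by (rule has_sum_infsum, rule summable_on_bounded_div[OF \<tau> m, where C = "pi + sqrt (of_int D) / \<bar>Im \<tau>\<bar>"])
       (use norm_root_log_le[of _ \<tau>] \<tau> in simp)
  have 2: "((\<lambda>Q. root_log Q (cnj w) / form_eval Q \<tau> 1 ^ m) has_sum
             (\<Sum>\<^sub>\<infinity>Q\<in>forms D. root_log Q (cnj w) / form_eval Q \<tau> 1 ^ m)) (forms D)"
    by (rule has_sum_infsum, rule summable_on_bounded_div[OF \<tau> m, where C = "pi + sqrt (of_int D) / \<bar>Im (cnj w)\<bar>"])
       (use norm_root_log_le[of _ "cnj w"] w in simp)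
  from has_sum_add[OF 1 has_sum_uminusI[OF 2]] show ?thesis
    unfolding Omega_eq[OF assms] by (simp add: infsumI diff_divide_distrib)
qed

text \<open>Only the sum over \<open>root_log Q (cnj w)\<close> depends on \<open>w\<close>, and its
  coefficients are \<open>O(1 / \<bar>Im w\<bar>)\<close> uniformly in \<open>Q\<close>. The filter
  constrains \<open>Im w\<close> alone and leaves \<open>Re w\<close> free.\<close>

lemma tendsto_Omega_psi:
  assumes m: "m \<ge> 3" and \<tau>: "Im \<tau> > 0"
  shows "((\<lambda>w. Omega m D \<tau> w) \<longlongrightarrow> psi m D \<tau>) (filtercomap Im at_bot)"
proof (rule LIM_zero_cancel, rule Lim_null_comparison)
  define s where "s = sqrt (of_int D)"
  have s: "s > 0"
    using sqrt_D_pos by (simp add: s_def)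
  have "((\<lambda>y::real. 2 * s * majorant m \<tau> / \<bar>y\<bar>) \<longlongrightarrow> 0) at_bot"
    by real_asymp
  then show "((\<lambda>w. 2 * s * majorant m \<tau> / \<bar>Im w\<bar>) \<longlongrightarrow> 0) (filtercomap Im at_bot)"
    by (rule filterlim_compose[OF _ filterlim_filtercomap])
  \<comment> \<open>The threshold \<open>2 * sqrt D\<close> is the one from which the small bound on
    \<open>root_log\<close> holds.\<close>
  have "\<forall>\<^sub>F y in at_bot. y < - 2 * s"
    by (rule eventually_gt_at_bot)
  then have "\<forall>\<^sub>F w in filtercomap Im at_bot. Im w < - 2 * s"
    by (rule eventually_filtercomapI)
  then show "\<forall>\<^sub>F w in filtercomap Im at_bot.
       norm (Omega m D \<tau> w - psi m D \<tau>) \<le> 2 * s * majorant m \<tau> / \<bar>Im w\<bar>"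
  proof eventually_elim
    case (elim w)
    then have w: "Im w < 0"
      using s by simp
    have "norm (Omega m D \<tau> w - psi m D \<tau>) =
            norm (\<Sum>\<^sub>\<infinity>Q\<in>forms D. root_log Q (cnj w) / form_eval Q \<tau> 1 ^ m)"
      unfolding Omega_eq_psi_minus[OF m \<tau> w] by simp
    also have "\<dots> \<le> 2 * s / \<bar>Im w\<bar> * majorant m \<tau>"
    proof (rule norm_infsum_bounded_div_le[OF \<tau> m])
      show "norm (root_log Q (cnj w)) \<le> 2 * s / \<bar>Im w\<bar>" if "Q \<in> forms D" for Q
        using norm_root_log_le_small[OF that, of "cnj w"] elim w by (simp add: s_def)
    qed
    finally show ?case
      by (simp add: mult_ac)
  qed
qed

lemma norm_root_log_diff_le:
  assumes Q: "Q \<in> forms D" and "\<delta> > 0" "Im z \<ge> \<delta>" "Im v > 0"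
  shows "norm (root_log Q z - root_log Q v) \<le> 2 * pi + sqrt (of_int D) / \<delta> + sqrt (of_int D) / Im v"
proof -
  have "norm (root_log Q z - root_log Q v) \<le> norm (root_log Q z) + norm (root_log Q v)"
    by (rule norm_triangle_ineq4)
  also have "\<dots> \<le> (pi + sqrt (of_int D) / Im z) + (pi + sqrt (of_int D) / Im v)"
    using norm_root_log_le[OF Q, of z] norm_root_log_le[OF Q, of v] assms by (intro add_mono) auto
  also have "sqrt (of_int D) / Im z \<le> sqrt (of_int D) / \<delta>"
    using assms sqrt_D_pos by (intro divide_left_mono) auto
  finally show ?thesis by simp
qed

text \<open>The coefficients stay bounded for \<open>Im \<tau> \<ge> 1\<close> but need not tend to
  0, as \<open>w\<close> is fixed; the decay comes from the majorant.\<close>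

lemma tendsto_Omega_0:
  assumes m: "m \<ge> 3" and w: "Im w < 0"
  shows "((\<lambda>\<tau>. Omega m D \<tau> w) \<longlongrightarrow> 0) (filtercomap Im at_top)"
proof -
  obtain C where C: "C \<ge> 0" "\<And>z. Im z \<ge> 1 \<Longrightarrow> majorant m z \<le> C / Im z"
    using majorant_decay[OF m] by blast
  define B where "B = 2 * pi + sqrt (of_int D) / 1 + sqrt (of_int D) / Im (cnj w)"
  have B: "B \<ge> 0"
    unfolding B_def using sqrt_D_pos w by (intro add_nonneg_nonneg divide_nonneg_pos) auto
  have "((\<lambda>y::real. B * C / y) \<longlongrightarrow> 0) at_top"
    by real_asymp
  then have lim: "((\<lambda>\<tau>. B * C / Im \<tau>) \<longlongrightarrow> 0) (filtercomap Im at_top)"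
    by (rule filterlim_compose[OF _ filterlim_filtercomap])
  have "\<forall>\<^sub>F \<tau> in filtercomap Im at_top. Im \<tau> \<ge> 1"
    by (rule eventually_filtercomapI) (rule eventually_ge_at_top)
  then have "\<forall>\<^sub>F \<tau> in filtercomap Im at_top. norm (Omega m D \<tau> w) \<le> B * C / Im \<tau>"
  proof eventually_elim
    case (elim \<tau>)
    have "norm (Omega m D \<tau> w) \<le> B * majorant m \<tau>"
      using norm_root_log_diff_le[of _ 1 \<tau> "cnj w"] elim m w
      by (subst Omega_eq) (auto intro!: norm_infsum_bounded_div_le simp: B_def)
    also have "\<dots> \<le> B * (C / Im \<tau>)"
      using elim B C by (intro mult_left_mono) auto
    finally show ?case by simp
  qed
  from this lim show ?thesis
    by (rule Lim_null_comparison)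
qed

section \<open>Holomorphy in each variable and vanishing on the diagonal\<close>

lemma holomorphic_Omega:
  assumes m: "m \<ge> 3" and w: "Im w < 0"
  shows "(\<lambda>\<tau>. Omega m D \<tau> w) holomorphic_on upper_half_plane"
proof -
  define summand where
    "summand Q \<tau> = (root_log Q \<tau> - root_log Q (cnj w)) / form_eval Q \<tau> 1 ^ m" for Q \<tau>
  have "(\<lambda>\<tau>. \<Sum>\<^sub>\<infinity>Q\<in>forms D. summand Q \<tau>) holomorphic_on upper_half_plane"
  proof (rule holomorphic_on_infsum)
    show "open upper_half_plane"
      by (simp add: upper_half_plane_def open_halfspace_Im_gt)
    show "summand Q holomorphic_on upper_half_plane" if Q: "Q \<in> forms D" for Q
    proof -
      have "(\<lambda>z. form_eval Q z 1) holomorphic_on upper_half_plane"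
        by (cases Q) (auto intro!: holomorphic_intros)
      with holomorphic_root_log[OF Q] show ?thesis
        unfolding summand_def using form_eval_nonzero[OF Q]
        by (intro holomorphic_intros) (auto simp: upper_half_plane_def)
    qed
    fix z assume "z \<in> upper_half_plane"
    then have z: "Im z > 0"
      by (simp add: upper_half_plane_def)
    \<comment> \<open>Half the height and a margin of 1 in width give an open box around
      \<open>z\<close> on which the box estimate for the denominators is uniform.\<close>
    define \<delta> R where "\<delta> = Im z / 2" and "R = \<bar>Re z\<bar> + 1"
    define B where "B = 2 * pi + sqrt (of_int D) / \<delta> + sqrt (of_int D) / Im (cnj w)"
    define M where "M Q = B * ((2 + (1 + 2 * R^2) / \<delta>^2) ^ m * norm (form_eval Q \<i> 1) powr (-5/2))" for Q
    define U where "U = {y. \<delta> < Im y} \<inter> {y. - R < Re y} \<inter> {y. Re y < R}"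
    have "M summable_on forms D"
      unfolding M_def by (intro summable_on_cmult_right summable_on_norm_form_eval_i_powr) simp
    moreover have "open U"
      unfolding U_def
      by (intro open_Int open_halfspace_Im_gt open_halfspace_Re_gt open_halfspace_Re_lt)
    moreover have "z \<in> U"
      using z by (auto simp: U_def \<delta>_def R_def)
    moreover have "norm (summand Q y) \<le> M Q" if Q: "Q \<in> forms D" and "y \<in> U" for Q y
    proof -
      have y: "\<bar>Re y\<bar> \<le> R" "\<delta> \<le> Im y" "\<delta> > 0"
        using \<open>y \<in> U\<close> z by (auto simp: U_def \<delta>_def)
      have "norm (root_log Q y - root_log Q (cnj w)) \<le> B"
        unfolding B_def using y w by (intro norm_root_log_diff_le[OF Q]) auto
      moreover from this have "B \<ge> 0"
        using norm_ge_zero order_trans by blast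
      ultimately show ?thesis
        unfolding summand_def M_def using norm_inverse_form_eval_le[OF Q y m]
        by (meson norm_term_le mult_left_mono order_trans)
    qed
    ultimately show "\<exists>U M. open U \<and> z \<in> U \<and> M summable_on forms D \<and>
        (\<forall>Q\<in>forms D. \<forall>y\<in>U \<inter> upper_half_plane. norm (summand Q y) \<le> M Q)"
      by (intro exI[of _ U] exI[of _ M]) auto
  qed
  then show ?thesis
    by (rule holomorphic_transform) (use m w in \<open>simp add: upper_half_plane_def Omega_eq summand_def\<close>)
qed

text \<open>With \<open>\<tau>\<close> fixed the denominators are constant, so bounding the
  logarithms near a point makes \<open>F\<close> holomorphic above the real line; \<open>w\<close>
  enters only through \<open>cnj w\<close>.\<close>

lemma antiholomorphic_Omega:
  assumes m: "m \<ge> 3" and \<tau>: "Im \<tau> > 0"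
  shows "antiholomorphic_on (\<lambda>w. Omega m D \<tau> w) lower_half_plane"
proof -
  define F where "F v = (\<Sum>\<^sub>\<infinity>Q\<in>forms D. root_log Q v / form_eval Q \<tau> 1 ^ m)" for v
  have "F holomorphic_on upper_half_plane"
    unfolding F_def
  proof (rule holomorphic_on_infsum)
    show "open upper_half_plane"
      by (simp add: upper_half_plane_def open_halfspace_Im_gt)
    show "(\<lambda>v. root_log Q v / form_eval Q \<tau> 1 ^ m) holomorphic_on upper_half_plane"
      if Q: "Q \<in> forms D" for Q
      using holomorphic_root_log[OF Q] form_eval_nonzero[OF Q] \<tau> by (intro holomorphic_intros) auto
    fix z assume "z \<in> upper_half_plane"
    then have z: "Im z > 0"
      by (simp add: upper_half_plane_def)
    define B where "B = pi + sqrt (of_int D) / (Im z / 2)"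
    define M where "M Q = B * inverse (norm (form_eval Q \<tau> 1)) ^ m" for Q
    define U where "U = {y. Im z / 2 < Im y}"
    have "M summable_on forms D"
      unfolding M_def by (intro summable_on_cmult_right summable_on_norm_inverse_form_eval m \<tau>)
    moreover have "open U" "z \<in> U"
      using z unfolding U_def by (simp_all only: open_halfspace_Im_gt) simp
    moreover have "norm (root_log Q y / form_eval Q \<tau> 1 ^ m) \<le> M Q" if Q: "Q \<in> forms D" and "y \<in> U" for Q y
      unfolding M_def
    proof (rule norm_term_le)
      have y: "Im z / 2 < Im y"
        using \<open>y \<in> U\<close> by (simp add: U_def)
      have "norm (root_log Q y) \<le> pi + sqrt (of_int D) / Im y"
        using norm_root_log_le[OF Q, of y] y z by simp
      also have "\<dots> \<le> B"
        unfolding B_def using y z sqrt_D_pos by (intro add_left_mono divide_left_mono mult_pos_pos) auto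
      finally show "norm (root_log Q y) \<le> B" .
    qed
    ultimately show "\<exists>U M. open U \<and> z \<in> U \<and> M summable_on forms D \<and>
        (\<forall>Q\<in>forms D. \<forall>y\<in>U \<inter> upper_half_plane. norm (root_log Q y / form_eval Q \<tau> 1 ^ m) \<le> M Q)"
      by (intro exI[of _ U] exI[of _ M]) auto
  qed
  then have "(\<lambda>v. psi m D \<tau> - F v) holomorphic_on upper_half_plane"
    by (intro holomorphic_intros)
  moreover have "cnj ` lower_half_plane \<subseteq> upper_half_plane"
    by (auto simp: upper_half_plane_def lower_half_plane_def)
  moreover have "open lower_half_plane"
    by (simp add: lower_half_plane_def open_halfspace_Im_lt)
  \<comment> \<open>Antiholomorphy means that the conjugate of \<open>Omega\<close> is holomorphic,
    and \<open>Omega\<close> at \<open>w\<close> is \<open>psi - F\<close> at \<open>cnj w\<close>;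
    conjugating on both sides preserves holomorphy.\<close>
  ultimately have "cnj \<circ> (\<lambda>v. psi m D \<tau> - F v) \<circ> cnj holomorphic_on lower_half_plane"
    by (intro holomorphic_on_compose_cnj_cnj) (auto intro: holomorphic_on_subset)
  then show ?thesis
    unfolding antiholomorphic_on_def
    by (rule holomorphic_transform)
       (use m \<tau> in \<open>simp add: lower_half_plane_def Omega_eq_psi_minus F_def\<close>)
qed

lemma Omega_diagonal:
  assumes "m \<ge> 3" "Im \<tau> > 0"
  shows "Omega m D \<tau> (cnj \<tau>) = 0"
  using assms by (simp add: Omega_eq)

end

theorem theorem1p1:
  fixes D :: int and k :: nat
  assumes "D > 0" and "discriminant D" and "\<not> is_square D" and "k \<ge> 1" and "even k"
  shows
    "(\<forall>\<tau>\<in>upper_half_plane. \<forall>w\<in>lower_half_plane.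
        Omega (k+1) D (\<tau> + 1) (w + 1) = Omega (k+1) D \<tau> w \<and>
        Omega (k+1) D (- 1 / \<tau>) (- 1 / w) = \<tau> ^ (2 * k + 2) * Omega (k+1) D \<tau> w) \<and>
     (\<forall>\<tau>\<in>upper_half_plane.
        ((\<lambda>w. Omega (k+1) D \<tau> w) \<longlongrightarrow> psi (k+1) D \<tau>) (filtercomap Im at_bot)) \<and>
     (\<forall>w\<in>lower_half_plane.
        ((\<lambda>\<tau>. Omega (k+1) D \<tau> w) \<longlongrightarrow> 0) (filtercomap Im at_top)) \<and>
     (\<forall>w\<in>lower_half_plane. (\<lambda>\<tau>. Omega (k+1) D \<tau> w) holomorphic_on upper_half_plane) \<and>
     (\<forall>\<tau>\<in>upper_half_plane. antiholomorphic_on (\<lambda>w. Omega (k+1) D \<tau> w) lower_half_plane) \<and>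
     (\<forall>\<tau>\<in>upper_half_plane. Omega (k+1) D \<tau> (cnj \<tau>) = 0)"
proof -
  interpret nonsquare_discriminant D
    using assms by unfold_locales
  \<comment> \<open>An even \<open>k \<ge> 1\<close> is at least 2, which gives the exponent 3
    required by the convergence estimates.\<close>
  have m: "k + 1 \<ge> 3"
    using assms by (auto elim: evenE)
  have weight: "2 * k + 2 = 2 * (k + 1)"
    by simp
  show ?thesis
    unfolding weight upper_half_plane_def lower_half_plane_def mem_Collect_eq Ball_def
    by (intro conjI allI impI Omega_translate[OF m] Omega_invert[OF m] tendsto_Omega_psi[OF m]
        tendsto_Omega_0[OF m] holomorphic_Omega[OF m, unfolded upper_half_plane_def]
        antiholomorphic_Omega[OF m, unfolded lower_half_plane_def] Omega_diagonal[OF m])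
qed

end
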